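(* Let $m,n$ be fixed nonzero integers with $m+n\neq0$. Let $\mathcal{N}$ be a nest on a separable complex Hilbert space $H$ and $\mathrm{alg}\mathcal{N}$ the associated nest algebra. If $\delta:\mathrm{alg}\mathcal{N}\to\mathrm{alg}\mathcal{N}$ is an $(m,n)$-derivable mapping at $0$, then $\delta$ is a derivation.
   Context: A nest on $H$ is a totally ordered collection of closed subspaces of $H$ containing $(0)$ and $H$ and closed under arbitrary intersections and closed linear spans. $\mathrm{alg}\mathcal{N}$ is the algebra of all bounded linear operators on $H$ leaving every member of $\mathcal{N}$ invariant. For a unital algebra $\mathcal{A}$, a linear map $\delta:\mathcal{A}\to\mathcal{A}$ is $(m,n)$-derivable at $0$ if $m\delta(AB)+n\delta(BA)=m\delta(A)B+mA\delta(B)+n\delta(B)A+nB\delta(A)$ for all $A,B\in\mathcal{A}$ with $AB=0$. It is a derivation if $\delta(AB)=\delta(A)B+A\delta(B)$ for all $A,B\in\mathcal{A}$. No continuity of $\delta$ is assumed.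
   Formalization: The Hilbert space H is assumed not to be one-dimensional; for dim H = 1 the nest algebra is the complex field, and the identity map is (m,n)-derivable at 0 without being a derivation, so the claim fails there. *)

theory Defs
  imports "HOL-Analysis.Analysis"
begin

text \<open>
  Complex inner product spaces, layered over the real class \<^class>\<open>real_inner\<close>: the real inner
  product is the real part of the complex one, so the norm is the usual
  \<open>\<parallel>x\<parallel> = sqrt (cinner x x)\<close>, and positive definiteness is inherited.
  The form is linear in its first argument.
\<close>

class complex_inner = real_inner +
  fixes scaleC :: "complex \<Rightarrow> 'a \<Rightarrow> 'a"  (infixr "*\<^sub>C" 75)
    and cinner :: "'a \<Rightarrow> 'a \<Rightarrow> complex"
  assumes scaleC_add_right: "c *\<^sub>C (x + y) = c *\<^sub>C x + c *\<^sub>C y"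
    and scaleC_add_left: "(c + d) *\<^sub>C x = c *\<^sub>C x + d *\<^sub>C x"
    and scaleC_scaleC: "c *\<^sub>C (d *\<^sub>C x) = (c * d) *\<^sub>C x"
    and scaleR_scaleC: "r *\<^sub>R x = complex_of_real r *\<^sub>C x"
    and cinner_commute: "cinner x y = cnj (cinner y x)"
    and cinner_add_left: "cinner (x + y) z = cinner x z + cinner y z"
    and cinner_scaleC_left: "cinner (c *\<^sub>C x) y = c * cinner x y"
    and inner_eq_Re_cinner: "inner x y = Re (cinner x y)"

class complex_hilbert_space = complex_inner + complete_space

lemma scaleC_one: "1 *\<^sub>C x = (x :: 'a::complex_inner)"
  using scaleR_scaleC[of 1 x] by simp

global_interpretation complex_vector: vector_space "scaleC :: complex \<Rightarrow> 'a \<Rightarrow> 'a::complex_inner"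
  by unfold_locales (simp_all add: scaleC_add_right scaleC_add_left scaleC_scaleC scaleC_one)

lemma norm_scaleC: "norm (c *\<^sub>C x) = cmod c * norm (x :: 'a::complex_inner)"
proof -
  have "Im (cinner x x) = 0"
    using cinner_commute[of x x] by (metis cnj.simps(2) neg_equal_zero)
  hence real: "cinner x x = complex_of_real (inner x x)"
    by (simp add: complex_eq_iff inner_eq_Re_cinner)
  have "cinner (c *\<^sub>C x) (c *\<^sub>C x) = c * cnj (cinner (c *\<^sub>C x) x)"
    by (metis cinner_commute cinner_scaleC_left)
  also have "\<dots> = (c * cnj c) * complex_of_real (inner x x)"
    by (simp add: cinner_scaleC_left real)
  also have "\<dots> = complex_of_real ((cmod c)\<^sup>2 * inner x x)"
    by (simp add: complex_norm_square[symmetric])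
  finally have "inner (c *\<^sub>C x) (c *\<^sub>C x) = (cmod c)\<^sup>2 * inner x x"
    by (simp add: inner_eq_Re_cinner del: of_real_mult)
  thus ?thesis
    by (simp add: norm_eq_sqrt_inner real_sqrt_mult)
qed

text \<open>
  Elements of \<^typ>\<open>'a \<Rightarrow>\<^sub>L 'b\<close> are only real-linear; complex linearity is imposed separately by
  \<open>clinear_op\<close>. Complex scalar multiples of operators are taken pointwise.
\<close>

lift_definition scaleC_op :: "complex \<Rightarrow> ('a::real_normed_vector \<Rightarrow>\<^sub>L 'b::complex_inner) \<Rightarrow> ('a \<Rightarrow>\<^sub>L 'b)"
  is "\<lambda>c A x. c *\<^sub>C A x"
proof -
  fix c :: complex and A :: "'a \<Rightarrow> 'b"
  assume A: "bounded_linear A"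
  have "bounded_linear (\<lambda>y :: 'b. c *\<^sub>C y)"
    by (rule bounded_linear_intro[where K = "cmod c"])
      (simp_all add: scaleC_add_right scaleR_scaleC scaleC_scaleC norm_scaleC mult.commute)
  from bounded_linear_compose[OF this A] show "bounded_linear (\<lambda>x. c *\<^sub>C A x)" .
qed

definition clinear_op :: "('a::complex_inner \<Rightarrow>\<^sub>L 'b::complex_inner) \<Rightarrow> bool"
  where "clinear_op A \<longleftrightarrow> (\<forall>c x. A (c *\<^sub>C x) = c *\<^sub>C A x)"

definition closed_csubspace :: "'a::complex_inner set \<Rightarrow> bool"
  where "closed_csubspace M \<longleftrightarrow> complex_vector.subspace M \<and> closed M"

definition nest :: "'a::complex_inner set set \<Rightarrow> bool"
  where "nest \<N> \<longleftrightarrow>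
    (\<forall>M\<in>\<N>. closed_csubspace M) \<and>
    (\<forall>L\<in>\<N>. \<forall>M\<in>\<N>. L \<subseteq> M \<or> M \<subseteq> L) \<and>
    {0} \<in> \<N> \<and> UNIV \<in> \<N> \<and>
    (\<forall>\<F>\<subseteq>\<N>. \<Inter>\<F> \<in> \<N>) \<and>
    (\<forall>\<F>\<subseteq>\<N>. closure (complex_vector.span (\<Union>\<F>)) \<in> \<N>)"

definition nest_alg :: "'a::complex_inner set set \<Rightarrow> ('a \<Rightarrow>\<^sub>L 'a) set"
  where "nest_alg \<N> = {A. clinear_op A \<and> (\<forall>M\<in>\<N>. blinfun_apply A ` M \<subseteq> M)}"

text \<open>
  Linear maps from an operator algebra into itself. The algebra is a set of operators rather than
  a type, so only the values of the map on that set matter.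
\<close>

definition linear_selfmap_on :: "('a \<Rightarrow>\<^sub>L 'a) set \<Rightarrow> (('a \<Rightarrow>\<^sub>L 'a) \<Rightarrow> ('a::complex_inner \<Rightarrow>\<^sub>L 'a)) \<Rightarrow> bool"
  where "linear_selfmap_on \<A> \<delta> \<longleftrightarrow>
    (\<forall>A\<in>\<A>. \<delta> A \<in> \<A>) \<and>
    (\<forall>A\<in>\<A>. \<forall>B\<in>\<A>. \<delta> (A + B) = \<delta> A + \<delta> B) \<and>
    (\<forall>c. \<forall>A\<in>\<A>. \<delta> (scaleC_op c A) = scaleC_op c (\<delta> A))"

definition derivable_at_zero ::
    "int \<Rightarrow> int \<Rightarrow> ('a \<Rightarrow>\<^sub>L 'a) set \<Rightarrow> (('a \<Rightarrow>\<^sub>L 'a) \<Rightarrow> ('a::complex_inner \<Rightarrow>\<^sub>L 'a)) \<Rightarrow> bool"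
  where "derivable_at_zero m n \<A> \<delta> \<longleftrightarrow>
    linear_selfmap_on \<A> \<delta> \<and>
    (\<forall>A\<in>\<A>. \<forall>B\<in>\<A>. A o\<^sub>L B = 0 \<longrightarrow>
      of_int m *\<^sub>R \<delta> (A o\<^sub>L B) + of_int n *\<^sub>R \<delta> (B o\<^sub>L A) =
      of_int m *\<^sub>R (\<delta> A o\<^sub>L B) + of_int m *\<^sub>R (A o\<^sub>L \<delta> B) +
      of_int n *\<^sub>R (\<delta> B o\<^sub>L A) + of_int n *\<^sub>R (B o\<^sub>L \<delta> A))"

definition derivation_on :: "('a \<Rightarrow>\<^sub>L 'a) set \<Rightarrow> (('a \<Rightarrow>\<^sub>L 'a) \<Rightarrow> ('a::complex_inner \<Rightarrow>\<^sub>L 'a)) \<Rightarrow> bool"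
  where "derivation_on \<A> \<delta> \<longleftrightarrow>
    linear_selfmap_on \<A> \<delta> \<and>
    (\<forall>A\<in>\<A>. \<forall>B\<in>\<A>. \<delta> (A o\<^sub>L B) = (\<delta> A o\<^sub>L B) + (A o\<^sub>L \<delta> B))"

text \<open>
  One-dimensional spaces have to be excluded from the theorem: there the nest algebra is the scalar
  field, \<open>A B = 0\<close> forces \<open>A = 0\<close> or \<open>B = 0\<close>, and hence every linear map, for instance the
  identity, is derivable at zero for all \<open>m\<close> and \<open>n\<close>, although only the zero map is a derivation.
  Since \<^const>\<open>complex_vector.dim\<close> is \<open>0\<close> on infinite-dimensional spaces, the condition
  \<open>complex_vector.dim UNIV \<noteq> 1\<close> excludes exactly this case.
\<close>

end

theory Submission
  imports Defs
begin

text \<open>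
  For an idempotent \<open>P\<close> of the algebra, the identity for the pair \<open>(P, 1 - P)\<close> shows that \<open>D = \<delta> 1\<close>
  commutes with \<open>P\<close>. Every rank-one operator of a nest algebra is a multiple of an idempotent or a
  difference of two, and an operator of the algebra annihilating all of them from the left is zero,
  so \<open>D\<close> is central. Subtracting \<open>A \<mapsto> D A\<close> and an inner derivation one may assume \<open>\<delta> P = 0\<close>; the
  identities for the pairs \<open>(A P, 1 - P)\<close> and \<open>(A (1 - P), P)\<close> then show that \<open>\<delta>\<close> respects the Peirce
  decomposition, i.e. \<open>\<delta> (A P) = \<delta> A P\<close>, and that \<open>D\<close> annihilates the off-diagonal corners, which
  forces \<open>D = 0\<close> unless the space is one-dimensional. Hence \<open>\<delta> (A X) = \<delta> A X + A \<delta> X\<close> for \<open>X\<close> of rank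
  one, and computing \<open>\<delta> (A B X)\<close> in two ways gives the derivation identity.
\<close>

section \<open>Peirce decompositions and maps derivable at zero\<close>

notation blinfun_compose (infixl "\<cdot>" 76)

lemmas blinfun_ring_simps =
  bounded_bilinear.add_left[OF bounded_bilinear_blinfun_compose]
  bounded_bilinear.add_right[OF bounded_bilinear_blinfun_compose]
  bounded_bilinear.diff_left[OF bounded_bilinear_blinfun_compose]
  bounded_bilinear.diff_right[OF bounded_bilinear_blinfun_compose]
  bounded_bilinear.minus_left[OF bounded_bilinear_blinfun_compose]
  bounded_bilinear.minus_right[OF bounded_bilinear_blinfun_compose]
  bounded_bilinear.scaleR_left[OF bounded_bilinear_blinfun_compose]
  bounded_bilinear.scaleR_right[OF bounded_bilinear_blinfun_compose]

lemma blinfun_compose_assoc: "(A \<cdot> B) \<cdot> C = A \<cdot> (B \<cdot> C)"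
  by (rule blinfun_eqI) simp

lemma blinfun_compose_id [simp]: "id_blinfun \<cdot> A = A" "A \<cdot> id_blinfun = A"
  by (auto intro: blinfun_eqI)

text \<open>
  Keeping \<open>P\<close> and \<open>Q = 1 - P\<close> as separate atoms lets the simplifier carry out Peirce decompositions.
\<close>

locale complementary_idempotents =
  fixes P Q :: "'a::real_normed_vector \<Rightarrow>\<^sub>L 'a"
  assumes sum_eq_id: "P + Q = id_blinfun" and idem: "P \<cdot> P = P"
begin

lemma Q_eq: "Q = id_blinfun - P"
  using sum_eq_id by (simp add: algebra_simps)

lemma peirce_simps [simp]:
  "P \<cdot> P = P" "P \<cdot> Q = 0" "Q \<cdot> P = 0" "Q \<cdot> Q = Q"
  "P \<cdot> (P \<cdot> X) = P \<cdot> X" "P \<cdot> (Q \<cdot> X) = 0" "Q \<cdot> (P \<cdot> X) = 0" "Q \<cdot> (Q \<cdot> X) = Q \<cdot> X"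
  by (simp_all add: idem Q_eq blinfun_ring_simps blinfun_compose_assoc[symmetric])

lemma compl: "complementary_idempotents Q P"
  by unfold_locales (use sum_eq_id in \<open>simp_all add: add.commute\<close>)

lemma split_left: "X = P \<cdot> X + Q \<cdot> X"
  by (simp add: Q_eq blinfun_ring_simps)

lemma split_right: "X = X \<cdot> P + X \<cdot> Q"
  by (simp add: Q_eq blinfun_ring_simps)

text \<open>Multiplying by \<open>P\<close> on the left leaves \<open>\<mu> P Y Q\<close>, and
  multiplying by \<open>Q\<close> on both sides leaves \<open>(\<mu> + \<nu>) Q Y Q\<close>, so both
  blocks of \<open>Y Q\<close> vanish.\<close>

lemma right_Q_eq_0:
  assumes "\<mu> *\<^sub>R (Y \<cdot> Q) + \<nu> *\<^sub>R (Q \<cdot> Y) = 0" "\<mu> \<noteq> 0" "\<mu> + \<nu> \<noteq> 0"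
  shows "Y \<cdot> Q = 0"
proof -
  have "P \<cdot> (\<mu> *\<^sub>R (Y \<cdot> Q) + \<nu> *\<^sub>R (Q \<cdot> Y)) = 0" "Q \<cdot> ((\<mu> *\<^sub>R (Y \<cdot> Q) + \<nu> *\<^sub>R (Q \<cdot> Y)) \<cdot> Q) = 0"
    by (simp_all only: assms blinfun_compose_zero)
  then have "\<mu> *\<^sub>R (P \<cdot> (Y \<cdot> Q)) = 0" "(\<mu> + \<nu>) *\<^sub>R (Q \<cdot> (Y \<cdot> Q)) = 0"
    by (simp_all add: blinfun_ring_simps blinfun_compose_assoc scaleR_add_left)
  with assms show ?thesis
    using split_left[of "Y \<cdot> Q"] by simp
qed

end

section \<open>Unital rings of operators and maps derivable at zero\<close>

locale operator_subring =
  fixes \<A> :: "('a::real_normed_vector \<Rightarrow>\<^sub>L 'a) set"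
  assumes id_mem [simp]: "id_blinfun \<in> \<A>"
    and diff_mem [simp]: "A \<in> \<A> \<Longrightarrow> B \<in> \<A> \<Longrightarrow> A - B \<in> \<A>"
    and comp_mem [simp]: "A \<in> \<A> \<Longrightarrow> B \<in> \<A> \<Longrightarrow> A \<cdot> B \<in> \<A>"
begin

lemma zero_mem [simp]: "0 \<in> \<A>"
  using diff_mem[of id_blinfun id_blinfun] by simp

lemma minus_mem [simp]: "A \<in> \<A> \<Longrightarrow> - A \<in> \<A>"
  using diff_mem[of 0 A] by simp

lemma add_mem [simp]: "A \<in> \<A> \<Longrightarrow> B \<in> \<A> \<Longrightarrow> A + B \<in> \<A>"
  using diff_mem[of A "- B"] by simp

text \<open>
  The condition is what rules out transposition-like components of \<open>\<delta>\<close>, mapping one off-diagonal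
  Peirce corner into the opposite one, which the identities alone permit when \<open>m = n\<close>.
\<close>

definition good_idempotent :: "('a \<Rightarrow>\<^sub>L 'a) \<Rightarrow> bool" where
  "good_idempotent P \<longleftrightarrow> P \<in> \<A> \<and> P \<cdot> P = P \<and>
    (\<forall>A\<in>\<A>. \<forall>B\<in>\<A>. (id_blinfun - P) \<cdot> A \<cdot> P \<cdot> B \<cdot> (id_blinfun - P) = 0 \<longrightarrow>
      (id_blinfun - P) \<cdot> A \<cdot> P = 0 \<or> P \<cdot> B \<cdot> (id_blinfun - P) = 0)"

end

text \<open>
  The element \<open>D\<close> measures the failure of \<open>\<delta> 1 = 0\<close>: if \<open>\<delta>\<close> is derivable at zero with
  \<open>\<delta> 1\<close> central, then \<open>A \<mapsto> \<delta> A - \<delta> 1 A\<close> satisfies the identity below with \<open>D = \<delta> 1\<close>.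
\<close>

locale twisted_derivable = operator_subring \<A> for \<A> :: "('a::real_normed_vector \<Rightarrow>\<^sub>L 'a) set" +
  fixes \<mu> \<nu> :: real and D :: "'a \<Rightarrow>\<^sub>L 'a" and \<delta> :: "('a \<Rightarrow>\<^sub>L 'a) \<Rightarrow> ('a \<Rightarrow>\<^sub>L 'a)"
  assumes coeffs: "\<mu> \<noteq> 0" "\<nu> \<noteq> 0" "\<mu> + \<nu> \<noteq> 0"
    and D_mem [simp]: "D \<in> \<A>"
    and D_central: "A \<in> \<A> \<Longrightarrow> A \<cdot> D = D \<cdot> A"
    and \<delta>_mem [simp]: "A \<in> \<A> \<Longrightarrow> \<delta> A \<in> \<A>"
    and \<delta>_add: "A \<in> \<A> \<Longrightarrow> B \<in> \<A> \<Longrightarrow> \<delta> (A + B) = \<delta> A + \<delta> B"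
    and \<delta>_id [simp]: "\<delta> id_blinfun = 0"
    and derivable: "A \<in> \<A> \<Longrightarrow> B \<in> \<A> \<Longrightarrow> A \<cdot> B = 0 \<Longrightarrow>
      \<nu> *\<^sub>R \<delta> (B \<cdot> A) = \<nu> *\<^sub>R (D \<cdot> (B \<cdot> A)) +
        \<mu> *\<^sub>R (\<delta> A \<cdot> B + A \<cdot> \<delta> B) + \<nu> *\<^sub>R (\<delta> B \<cdot> A + B \<cdot> \<delta> A)"
begin

lemma \<delta>_zero [simp]: "\<delta> 0 = 0"
  using \<delta>_add[of 0 0] by simp

lemma \<delta>_diff: "A \<in> \<A> \<Longrightarrow> B \<in> \<A> \<Longrightarrow> \<delta> (A - B) = \<delta> A - \<delta> B"
  using \<delta>_add[of "A - B" B] by (simp add: algebra_simps)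

lemma square_zero:
  assumes "X \<in> \<A>" "X \<cdot> X = 0"
  shows "\<delta> X \<cdot> X + X \<cdot> \<delta> X = 0"
proof -
  have "(\<mu> + \<nu>) *\<^sub>R (\<delta> X \<cdot> X + X \<cdot> \<delta> X) = 0"
    using derivable[of X X] assms by (simp add: scaleR_add_left)
  with coeffs show ?thesis by simp
qed

text \<open>An inner derivation \<open>d\<close> satisfies \<open>d (B A) = d B A + B d A\<close>,
  and \<open>d A B + A d B = d (A B) = 0\<close> when \<open>A B = 0\<close>, so subtracting it
  preserves the identity; it also vanishes at the identity operator.\<close>

lemma sub_inner:
  assumes W: "W \<in> \<A>"
  shows "twisted_derivable \<A> \<mu> \<nu> D (\<lambda>A. \<delta> A - (W \<cdot> A - A \<cdot> W))"
proof unfold_locales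
  fix A B assume AB: "A \<in> \<A>" "B \<in> \<A>" "A \<cdot> B = 0"
  then have "A \<cdot> (B \<cdot> W) = 0" by (simp add: blinfun_compose_assoc[symmetric])
  with AB show "\<nu> *\<^sub>R (\<delta> (B \<cdot> A) - (W \<cdot> (B \<cdot> A) - B \<cdot> A \<cdot> W)) =
      \<nu> *\<^sub>R (D \<cdot> (B \<cdot> A)) +
      \<mu> *\<^sub>R ((\<delta> A - (W \<cdot> A - A \<cdot> W)) \<cdot> B + A \<cdot> (\<delta> B - (W \<cdot> B - B \<cdot> W))) +
      \<nu> *\<^sub>R ((\<delta> B - (W \<cdot> B - B \<cdot> W)) \<cdot> A + B \<cdot> (\<delta> A - (W \<cdot> A - A \<cdot> W)))"
    using derivable[of A B] by (simp add: blinfun_ring_simps blinfun_compose_assoc algebra_simps)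
qed (use W coeffs in \<open>auto simp: D_central \<delta>_add blinfun_ring_simps algebra_simps\<close>)

text \<open>Both products of the pair \<open>(X, Q)\<close> are zero, so the identity reduces to
  \<open>\<mu> \<delta> X Q + \<nu> Q \<delta> X = 0\<close>.\<close>

lemma diagonal_corner:
  assumes PQ: "complementary_idempotents P Q" and mem: "P \<in> \<A>" "Q \<in> \<A>" "X \<in> \<A>"
    and "\<delta> Q = 0" and X: "Q \<cdot> X = 0" "X \<cdot> Q = 0"
  shows "\<delta> X \<cdot> Q = 0"
proof -
  interpret complementary_idempotents P Q by (rule PQ)
  show ?thesis
    using derivable[of X Q] assms coeffs by (intro right_Q_eq_0[of \<mu> _ \<nu>]) simp_all
qed

text \<open>The identity for \<open>(X, Q)\<close> is read block by block: the diagonal blocks of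
  \<open>\<delta> X\<close> vanish, and the block containing \<open>X\<close> gives
  \<open>D X = 0\<close>. For the opposite block it says only
  \<open>(\<nu> - \<mu>) P \<delta> X Q = 0\<close>, which is void when
  \<open>\<mu> = \<nu>\<close>; the last two conclusions come from \<open>square_zero\<close>
  instead.\<close>

lemma off_diagonal_corner:
  assumes PQ: "complementary_idempotents P Q" and mem: "P \<in> \<A>" "Q \<in> \<A>" "X \<in> \<A>"
    and "\<delta> Q = 0" and X: "Q \<cdot> X = X" "X \<cdot> P = X"
  shows "D \<cdot> X = 0" "P \<cdot> \<delta> X \<cdot> P = 0" "Q \<cdot> \<delta> X \<cdot> Q = 0"
    "P \<cdot> \<delta> X \<cdot> Q \<cdot> X = 0" "X \<cdot> (P \<cdot> \<delta> X \<cdot> Q) = 0"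
proof -
  interpret complementary_idempotents P Q by (rule PQ)
  let ?Y = "\<delta> X"
  have XQ: "X \<cdot> Q = 0" by (subst X(2)[symmetric]) (simp add: blinfun_compose_assoc)
  have PX: "P \<cdot> X = 0" by (subst X(1)[symmetric]) simp
  have XQ': "X \<cdot> (Q \<cdot> Z) = 0" and PX': "P \<cdot> (X \<cdot> Z) = 0" for Z
    by (simp_all add: XQ PX blinfun_compose_assoc[symmetric])
  have XP': "X \<cdot> (P \<cdot> Z) = X \<cdot> Z" and QX': "Q \<cdot> (X \<cdot> Z) = X \<cdot> Z" for Z
    by (simp_all add: X blinfun_compose_assoc[symmetric])
  note s = XQ PX XQ' PX' XP' QX' X blinfun_ring_simps blinfun_compose_assoc
  have rel: "\<nu> *\<^sub>R ?Y = \<nu> *\<^sub>R (D \<cdot> X) + \<mu> *\<^sub>R (?Y \<cdot> Q) + \<nu> *\<^sub>R (Q \<cdot> ?Y)"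
    using derivable[of X Q] assms by (simp add: XQ)
  have corner: "\<nu> *\<^sub>R (R \<cdot> ?Y \<cdot> S) = \<nu> *\<^sub>R (R \<cdot> (D \<cdot> X) \<cdot> S) +
      \<mu> *\<^sub>R (R \<cdot> (?Y \<cdot> Q) \<cdot> S) + \<nu> *\<^sub>R (R \<cdot> (Q \<cdot> ?Y) \<cdot> S)" for R S
    using arg_cong[OF rel, of "\<lambda>Z. R \<cdot> Z \<cdot> S"] by (simp add: blinfun_ring_simps)
  have DX: "D \<cdot> X = X \<cdot> D" using D_central mem by simp
  have DP: "D \<cdot> P = P \<cdot> D" and DQ: "D \<cdot> Q = Q \<cdot> D" using D_central mem by simp_all
  show "P \<cdot> ?Y \<cdot> P = 0"
    using corner[of P P] coeffs by (simp add: s DX DP)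
  show "Q \<cdot> ?Y \<cdot> Q = 0"
    using corner[of Q Q] coeffs by (simp add: s DX DP DQ)
  show "D \<cdot> X = 0"
    using corner[of Q P] coeffs by (simp add: s DX DP DQ)
  have sq: "?Y \<cdot> X + X \<cdot> ?Y = 0"
    using square_zero[of X] mem XP'[of X] by (simp add: PX)
  have "P \<cdot> (?Y \<cdot> X + X \<cdot> ?Y) = 0" "(?Y \<cdot> X + X \<cdot> ?Y) \<cdot> Q = 0"
    by (simp_all only: sq blinfun_compose_zero)
  then show "P \<cdot> ?Y \<cdot> Q \<cdot> X = 0" "X \<cdot> (P \<cdot> ?Y \<cdot> Q) = 0"
    by (simp_all add: s)
qed

lemma \<delta>_idempotent:
  assumes "P \<in> \<A>" "P \<cdot> P = P"
  shows "\<delta> P = \<delta> P \<cdot> P + P \<cdot> \<delta> P"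
proof -
  let ?Q = "id_blinfun - P"
  have "(\<mu> + \<nu>) *\<^sub>R (\<delta> P - (\<delta> P \<cdot> P + P \<cdot> \<delta> P)) = 0"
    using derivable[of P ?Q] assms by (simp add: \<delta>_diff blinfun_ring_simps algebra_simps)
  with coeffs show ?thesis by simp
qed

text \<open>Splitting \<open>A\<close> into its four Peirce corners gives
  \<open>\<delta> (A P) Q = 0\<close> and \<open>\<delta> (A Q) P = 0\<close>, hence
  \<open>\<delta> (A P) = \<delta> (A P) P = \<delta> A P\<close>.\<close>

lemma peirce_normalized:
  assumes good: "good_idempotent P" and "\<delta> P = 0" and A: "A \<in> \<A>"
  shows "\<delta> (A \<cdot> P) = \<delta> A \<cdot> P" "D \<cdot> ((id_blinfun - P) \<cdot> A \<cdot> P) = 0" "D \<cdot> (P \<cdot> A \<cdot> (id_blinfun - P)) = 0"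
proof -
  define Q where "Q = id_blinfun - P"
  from good have P: "P \<in> \<A>" "P \<cdot> P = P" by (auto simp: good_idempotent_def)
  then have Q: "Q \<in> \<A>" by (simp add: Q_def)
  interpret complementary_idempotents P Q
    by unfold_locales (simp_all add: Q_def P)
  have \<delta>Q: "\<delta> Q = 0" using assms P by (simp add: Q_def \<delta>_diff)
  have good': "X = 0 \<or> Y = 0" if "X \<in> \<A>" "Y \<in> \<A>" "Q \<cdot> X = X" "X \<cdot> P = X" "P \<cdot> Y = Y" "Y \<cdot> Q = Y" "X \<cdot> Y = 0" for X Y
  proof -
    have "Q \<cdot> X \<cdot> P \<cdot> Y \<cdot> Q = 0" "Q \<cdot> X \<cdot> P = X" "P \<cdot> Y \<cdot> Q = Y"
      using that by (simp_all add: blinfun_compose_assoc)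
    with good that show ?thesis unfolding good_idempotent_def Q_def[symmetric] by metis
  qed
  have c11: "\<delta> (P \<cdot> A \<cdot> P) \<cdot> Q = 0"
    by (rule diagonal_corner[of P]) (use P Q A \<delta>Q in \<open>simp_all add: complementary_idempotents_axioms blinfun_compose_assoc\<close>)
  have c22: "\<delta> (Q \<cdot> A \<cdot> Q) \<cdot> P = 0"
    by (rule diagonal_corner[of Q]) (use P Q A assms in \<open>simp_all add: compl blinfun_compose_assoc\<close>)
  note c21 = off_diagonal_corner[OF complementary_idempotents_axioms, of "Q \<cdot> A \<cdot> P"]
  note c12 = off_diagonal_corner[OF compl, of "P \<cdot> A \<cdot> Q"]
  note s = P Q A \<delta>Q \<open>\<delta> P = 0\<close> blinfun_compose_assoc
  show "D \<cdot> ((id_blinfun - P) \<cdot> A \<cdot> P) = 0" "D \<cdot> (P \<cdot> A \<cdot> (id_blinfun - P)) = 0"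
    unfolding Q_def[symmetric] by (rule c21 c12; simp add: s)+
  let ?X = "Q \<cdot> A \<cdot> P" and ?Y = "P \<cdot> A \<cdot> Q"
  \<comment> \<open>Here \<open>X (P \<delta> X Q) = 0\<close> is a vanishing product of opposite
    corners, so goodness of \<open>P\<close> makes one factor zero; if that factor is
    \<open>X\<close>, then \<open>\<delta> X = 0\<close> anyway.\<close>
  have "?X = 0 \<or> P \<cdot> \<delta> ?X \<cdot> Q = 0"
    by (rule good') (use c21(5) in \<open>simp_all add: s\<close>)
  then have "P \<cdot> \<delta> ?X \<cdot> Q = 0" by auto
  moreover have "Q \<cdot> \<delta> ?X \<cdot> Q = 0" by (rule c21; simp add: s)
  ultimately have "\<delta> ?X \<cdot> Q = 0"
    using split_left[of "\<delta> ?X \<cdot> Q"] by (simp add: s)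
  with c11 have AP: "\<delta> (A \<cdot> P) \<cdot> Q = 0"
    using split_left[of "A \<cdot> P"] \<delta>_add[of "P \<cdot> (A \<cdot> P)" "Q \<cdot> (A \<cdot> P)"] by (simp add: s blinfun_ring_simps)
  have "Q \<cdot> \<delta> ?Y \<cdot> P = 0 \<or> ?Y = 0"
    by (rule good') (use c12(4) in \<open>simp_all add: s\<close>)
  then have "Q \<cdot> \<delta> ?Y \<cdot> P = 0" by auto
  moreover have "P \<cdot> \<delta> ?Y \<cdot> P = 0" by (rule c12; simp add: s)
  ultimately have "\<delta> ?Y \<cdot> P = 0"
    using split_left[of "\<delta> ?Y \<cdot> P"] by (simp add: s)
  with c22 have AQ: "\<delta> (A \<cdot> Q) \<cdot> P = 0"
    using split_left[of "A \<cdot> Q"] \<delta>_add[of "P \<cdot> (A \<cdot> Q)" "Q \<cdot> (A \<cdot> Q)"] by (simp add: s blinfun_ring_simps)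
  show "\<delta> (A \<cdot> P) = \<delta> A \<cdot> P"
    using AP AQ split_right[of "\<delta> (A \<cdot> P)"] split_right[of A] \<delta>_add[of "A \<cdot> P" "A \<cdot> Q"]
    by (simp add: s blinfun_ring_simps)
qed

text \<open>
  Since \<open>E = \<delta> P\<close> satisfies \<open>E = E P + P E\<close>, it is the value at \<open>P\<close> of the inner derivation by \<open>E P - P E\<close>.
\<close>

lemma peirce:
  assumes good: "good_idempotent P" and A: "A \<in> \<A>"
  shows "\<delta> (A \<cdot> P) = \<delta> A \<cdot> P + A \<cdot> \<delta> P" "D \<cdot> ((id_blinfun - P) \<cdot> A \<cdot> P) = 0" "D \<cdot> (P \<cdot> A \<cdot> (id_blinfun - P)) = 0"
proof -
  from good have P: "P \<in> \<A>" "P \<cdot> P = P" by (auto simp: good_idempotent_def)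
  have E: "\<delta> P = \<delta> P \<cdot> P + P \<cdot> \<delta> P" by (rule \<delta>_idempotent[OF P])
  define W where "W = \<delta> P \<cdot> P - P \<cdot> \<delta> P"
  have W: "W \<in> \<A>" using P by (simp add: W_def)
  interpret inner: twisted_derivable \<A> \<mu> \<nu> D "\<lambda>A. \<delta> A - (W \<cdot> A - A \<cdot> W)"
    by (rule sub_inner[OF W])
  interpret complementary_idempotents P "id_blinfun - P"
    by unfold_locales (simp_all add: P)
  \<comment> \<open>With \<open>E = \<delta> P\<close>, compressing \<open>E = E P + P E\<close> by
    \<open>P\<close> on both sides gives \<open>P E P = 2 P E P\<close>, so
    \<open>P E P = 0\<close>.\<close>
  have "P \<cdot> (\<delta> P \<cdot> P + P \<cdot> \<delta> P) \<cdot> P = P \<cdot> \<delta> P \<cdot> P" by (simp only: E[symmetric])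
  then have "P \<cdot> (\<delta> P \<cdot> P) = 0"
    by (simp add: blinfun_ring_simps blinfun_compose_assoc)
  then have WP: "W \<cdot> P - P \<cdot> W = \<delta> P"
    by (subst E) (simp add: W_def blinfun_ring_simps blinfun_compose_assoc)
  then have 0: "\<delta> P - (W \<cdot> P - P \<cdot> W) = 0" by simp
  note n = inner.peirce_normalized[OF good 0 A]
  show "D \<cdot> ((id_blinfun - P) \<cdot> A \<cdot> P) = 0" "D \<cdot> (P \<cdot> A \<cdot> (id_blinfun - P)) = 0"
    by (rule n)+
  have "A \<cdot> (W \<cdot> P - P \<cdot> W) = A \<cdot> \<delta> P" by (simp only: WP)
  with n(1) show "\<delta> (A \<cdot> P) = \<delta> A \<cdot> P + A \<cdot> \<delta> P"
    by (simp add: blinfun_ring_simps blinfun_compose_assoc algebra_simps)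
qed

end

section \<open>The image of the identity operator\<close>

locale zero_derivable = operator_subring \<A> for \<A> :: "('a::real_normed_vector \<Rightarrow>\<^sub>L 'a) set" +
  fixes \<mu> \<nu> :: real and \<delta> :: "('a \<Rightarrow>\<^sub>L 'a) \<Rightarrow> ('a \<Rightarrow>\<^sub>L 'a)"
  assumes coeffs: "\<mu> \<noteq> 0" "\<nu> \<noteq> 0" "\<mu> + \<nu> \<noteq> 0"
    and \<delta>_mem [simp]: "A \<in> \<A> \<Longrightarrow> \<delta> A \<in> \<A>"
    and \<delta>_add: "A \<in> \<A> \<Longrightarrow> B \<in> \<A> \<Longrightarrow> \<delta> (A + B) = \<delta> A + \<delta> B"
    and derivable: "A \<in> \<A> \<Longrightarrow> B \<in> \<A> \<Longrightarrow> A \<cdot> B = 0 \<Longrightarrow>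
      \<nu> *\<^sub>R \<delta> (B \<cdot> A) = \<mu> *\<^sub>R (\<delta> A \<cdot> B + A \<cdot> \<delta> B) + \<nu> *\<^sub>R (\<delta> B \<cdot> A + B \<cdot> \<delta> A)"
begin

text \<open>With \<open>\<delta> Q = D - \<delta> P\<close>, the off-diagonal corners of the
  identity for \<open>(P, Q)\<close> read \<open>\<mu> P D Q = 0\<close> and
  \<open>\<nu> Q D P = 0\<close>.\<close>

lemma \<delta>_id_commutes:
  assumes P: "P \<in> \<A>" "P \<cdot> P = P"
  shows "\<delta> id_blinfun \<cdot> P = P \<cdot> \<delta> id_blinfun"
proof -
  define Q where "Q = id_blinfun - P"
  define D where "D = \<delta> id_blinfun"
  interpret complementary_idempotents P Q
    by unfold_locales (simp_all add: Q_def P)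
  have Q: "Q \<in> \<A>" using P by (simp add: Q_def)
  have "\<delta> P + \<delta> Q = D" using \<delta>_add[of P Q] P Q by (simp add: sum_eq_id D_def)
  then have "\<delta> Q = D - \<delta> P" by (simp add: algebra_simps)
  then have rel: "\<mu> *\<^sub>R (\<delta> P \<cdot> Q + P \<cdot> (D - \<delta> P)) + \<nu> *\<^sub>R ((D - \<delta> P) \<cdot> P + Q \<cdot> \<delta> P) = 0"
    using derivable[of P Q] \<delta>_add[of 0 0] P Q by simp
  have "P \<cdot> (\<mu> *\<^sub>R (\<delta> P \<cdot> Q + P \<cdot> (D - \<delta> P)) + \<nu> *\<^sub>R ((D - \<delta> P) \<cdot> P + Q \<cdot> \<delta> P)) \<cdot> Q = 0"
    "Q \<cdot> (\<mu> *\<^sub>R (\<delta> P \<cdot> Q + P \<cdot> (D - \<delta> P)) + \<nu> *\<^sub>R ((D - \<delta> P) \<cdot> P + Q \<cdot> \<delta> P)) \<cdot> P = 0"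
    unfolding rel by simp_all
  then have "P \<cdot> (D \<cdot> Q) = 0" "Q \<cdot> (D \<cdot> P) = 0"
    using coeffs by (simp_all add: blinfun_ring_simps blinfun_compose_assoc)
  then show ?thesis
    using split_left[of "D \<cdot> P"] split_right[of "P \<cdot> D"]
    by (simp add: D_def blinfun_compose_assoc)
qed

text \<open>When \<open>A B = 0\<close> and \<open>D\<close> is central, the map
  \<open>A \<mapsto> D A\<close> contributes \<open>\<nu> D B A\<close> on the left of the identity
  and \<open>2 \<nu> D B A\<close> on the right; the difference is the term with
  \<open>D\<close>.\<close>

lemma twisted:
  assumes central: "\<And>A. A \<in> \<A> \<Longrightarrow> A \<cdot> \<delta> id_blinfun = \<delta> id_blinfun \<cdot> A"
  shows "twisted_derivable \<A> \<mu> \<nu> (\<delta> id_blinfun) (\<lambda>A. \<delta> A - \<delta> id_blinfun \<cdot> A)"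
proof unfold_locales
  let ?D = "\<delta> id_blinfun"
  fix A B assume AB: "A \<in> \<A>" "B \<in> \<A>" "A \<cdot> B = 0"
  have c: "A \<cdot> (?D \<cdot> Z) = ?D \<cdot> (A \<cdot> Z)" "B \<cdot> (?D \<cdot> Z) = ?D \<cdot> (B \<cdot> Z)" for Z :: "'a \<Rightarrow>\<^sub>L 'a"
    by (simp_all add: blinfun_compose_assoc[symmetric] central AB)
  show "\<nu> *\<^sub>R (\<delta> (B \<cdot> A) - ?D \<cdot> (B \<cdot> A)) = \<nu> *\<^sub>R (?D \<cdot> (B \<cdot> A)) +
      \<mu> *\<^sub>R ((\<delta> A - ?D \<cdot> A) \<cdot> B + A \<cdot> (\<delta> B - ?D \<cdot> B)) +
      \<nu> *\<^sub>R ((\<delta> B - ?D \<cdot> B) \<cdot> A + B \<cdot> (\<delta> A - ?D \<cdot> A))"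
    using derivable[of A B] AB by (simp add: blinfun_ring_simps blinfun_compose_assoc c algebra_simps)
qed (use coeffs central in \<open>auto simp: \<delta>_add blinfun_ring_simps algebra_simps\<close>)

end

section \<open>Extending identities from a separating left ideal\<close>

text \<open>Both \<open>X\<close> and \<open>B X\<close> lie in \<open>\<J>\<close>, so
  \<open>\<delta> (A B X)\<close> expands with either as the right factor. The intended
  \<open>\<J>\<close> consists of operators of rank at most one, which in general are not closed
  under sums.\<close>

lemma (in operator_subring) derivation_if_on_separating_left_ideal:
  assumes J: "\<And>A X. A \<in> \<A> \<Longrightarrow> X \<in> \<J> \<Longrightarrow> A \<cdot> X \<in> \<J>"
    and separating: "\<And>T. T \<in> \<A> \<Longrightarrow> (\<And>X. X \<in> \<J> \<Longrightarrow> T \<cdot> X = 0) \<Longrightarrow> T = 0"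
    and mem: "\<And>A. A \<in> \<A> \<Longrightarrow> \<delta> A \<in> \<A>"
    and deriv: "\<And>A X. A \<in> \<A> \<Longrightarrow> X \<in> \<J> \<Longrightarrow> \<delta> (A \<cdot> X) = \<delta> A \<cdot> X + A \<cdot> \<delta> X"
    and AB: "A \<in> \<A>" "B \<in> \<A>"
  shows "\<delta> (A \<cdot> B) = \<delta> A \<cdot> B + A \<cdot> \<delta> B"
proof -
  have "(\<delta> (A \<cdot> B) - (\<delta> A \<cdot> B + A \<cdot> \<delta> B)) \<cdot> X = 0" if X: "X \<in> \<J>" for X
  proof -
    have "\<delta> (A \<cdot> B) \<cdot> X + A \<cdot> B \<cdot> \<delta> X = \<delta> (A \<cdot> (B \<cdot> X))"
      using deriv[of "A \<cdot> B" X] AB X by (simp add: blinfun_compose_assoc)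
    also have "\<dots> = \<delta> A \<cdot> (B \<cdot> X) + A \<cdot> (\<delta> B \<cdot> X + B \<cdot> \<delta> X)"
      using deriv[of A "B \<cdot> X"] deriv[of B X] AB X J by simp
    finally show ?thesis
      by (simp add: blinfun_ring_simps blinfun_compose_assoc)
  qed
  from separating[OF _ this] show ?thesis
    using AB mem by simp
qed

text \<open>\<open>A D X = A X D = D A X\<close>, the second equality because \<open>A X\<close> is
  again in \<open>\<J>\<close>.\<close>

lemma (in operator_subring) central_if_on_separating_left_ideal:
  assumes J: "\<And>A X. A \<in> \<A> \<Longrightarrow> X \<in> \<J> \<Longrightarrow> A \<cdot> X \<in> \<J>"
    and separating: "\<And>T. T \<in> \<A> \<Longrightarrow> (\<And>X. X \<in> \<J> \<Longrightarrow> T \<cdot> X = 0) \<Longrightarrow> T = 0"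
    and commutes: "\<And>X. X \<in> \<J> \<Longrightarrow> D \<cdot> X = X \<cdot> D"
    and mem: "D \<in> \<A>" "A \<in> \<A>"
  shows "A \<cdot> D = D \<cdot> A"
proof -
  have "(A \<cdot> D - D \<cdot> A) \<cdot> X = 0" if X: "X \<in> \<J>" for X
    using commutes[OF X] commutes[OF J[OF mem(2) X]]
    by (simp add: blinfun_ring_simps blinfun_compose_assoc)
  from separating[OF _ this] show ?thesis
    using mem by simp
qed

section \<open>Rank-one operators and projections\<close>

lemma cinner_zero_left [simp]: "cinner 0 y = 0"
  using cinner_add_left[of 0 0 y] by simp

lemma cinner_add_right: "cinner x (y + z) = cinner x y + cinner x z"
  by (metis cinner_commute cinner_add_left complex_cnj_add)

lemma cinner_scaleC_right: "cinner x (c *\<^sub>C y) = cnj c * cinner x y"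
  by (metis cinner_commute cinner_scaleC_left complex_cnj_mult)

lemma cinner_diff_left: "cinner (x - y) z = cinner x z - cinner y z"
  using cinner_add_left[of "x - y" y z] by simp

lemma Im_cinner: "Im (cinner x y) = inner ((- \<i>) *\<^sub>C x) y"
  by (simp add: inner_eq_Re_cinner cinner_scaleC_left del: complex_vector.scale_minus_left)

lemma cinner_self_eq_0_iff [simp]: "cinner x x = 0 \<longleftrightarrow> x = 0"
  by (metis cinner_zero_left inner_eq_Re_cinner inner_eq_zero_iff zero_complex.sel(1))

text \<open>The factor 2 comes from bounding real and imaginary parts separately by the real
  Cauchy-Schwarz inequality; this suffices for the boundedness of \<open>outer\<close>.\<close>

lemma norm_cinner_le: "norm (cinner x y) \<le> 2 * (norm x * norm y)"
proof -
  have "\<bar>Re (cinner x y)\<bar> \<le> norm x * norm y"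
    by (metis Cauchy_Schwarz_ineq2 inner_eq_Re_cinner)
  moreover have "\<bar>Im (cinner x y)\<bar> \<le> norm x * norm y"
    using Cauchy_Schwarz_ineq2[of "(- \<i>) *\<^sub>C x" y] by (simp add: Im_cinner norm_scaleC)
  ultimately show ?thesis
    using cmod_le[of "cinner x y"] by linarith
qed

text \<open>The rank-one operator usually written \<open>x \<otimes> f\<close>, where the vector
  \<open>f\<close> represents a functional.\<close>

lift_definition outer :: "'a::complex_inner \<Rightarrow> 'a \<Rightarrow> 'a \<Rightarrow>\<^sub>L 'a"
  is "\<lambda>x f z. cinner z f *\<^sub>C x"
proof -
  fix x f :: 'a
  show "bounded_linear (\<lambda>z. cinner z f *\<^sub>C x)"
  proof (rule bounded_linear_intro[where K = "2 * norm f * norm x"])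
    show "norm (cinner z f *\<^sub>C x) \<le> norm z * (2 * norm f * norm x)" for z
      using mult_right_mono[OF norm_cinner_le[of z f], of "norm x"]
      by (simp add: norm_scaleC ac_simps)
  qed (simp_all add: cinner_add_left scaleC_add_left scaleR_scaleC scaleC_scaleC cinner_scaleC_left)
qed

declare outer.rep_eq [simp] scaleC_op.rep_eq [simp]

lemma clinear_opD: "clinear_op A \<Longrightarrow> A (c *\<^sub>C x) = c *\<^sub>C A x"
  by (simp add: clinear_op_def)

lemma clinear_outer: "clinear_op (outer x f)"
  by (simp add: clinear_op_def cinner_scaleC_left scaleC_scaleC)

lemma compose_outer: "clinear_op A \<Longrightarrow> A \<cdot> outer x f = outer (A x) f"
  by (rule blinfun_eqI) (simp add: clinear_opD)

lemma compose_scaleC_op_right: "clinear_op A \<Longrightarrow> A \<cdot> scaleC_op c B = scaleC_op c (A \<cdot> B)"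
  by (rule blinfun_eqI) (simp add: clinear_opD)

lemma compose_scaleC_op_left: "scaleC_op c A \<cdot> B = scaleC_op c (A \<cdot> B)"
  by (rule blinfun_eqI) simp

lemma scaleC_op_add: "scaleC_op c (A + B) = scaleC_op c A + scaleC_op c B"
  by (rule blinfun_eqI) (simp add: blinfun.bilinear_simps scaleC_add_right)

lemma outer_diff_left: "outer (x - y) f = outer x f - outer y f"
  by (rule blinfun_eqI) (simp add: blinfun.bilinear_simps complex_vector.scale_right_diff_distrib)

section \<open>Nearest points and orthogonal projections\<close>

lemma nearest_point_orthogonal:
  fixes S :: "'a::real_inner set"
  assumes S: "subspace S" "y \<in> S" and nearest: "\<And>z. z \<in> S \<Longrightarrow> dist x y \<le> dist x z" and z: "z \<in> S"
  shows "inner (x - y) z = 0"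
proof (cases "z = 0")
  case False
  \<comment> \<open>This \<open>t\<close> minimizes the norm of \<open>x - y - t z\<close>.\<close>
  define t where "t = inner (x - y) z / inner z z"
  have "y + t *\<^sub>R z \<in> S" using S z by (simp add: subspace_add subspace_mul)
  then have "(norm (x - y))\<^sup>2 \<le> (norm (x - (y + t *\<^sub>R z)))\<^sup>2"
    using nearest by (intro power_mono) (auto simp: dist_norm)
  also have "\<dots> = (norm (x - y))\<^sup>2 - 2 * t * inner (x - y) z + t\<^sup>2 * inner z z"
    unfolding power2_norm_eq_inner by (simp add: algebra_simps inner_commute power2_eq_square)
  also have "\<dots> = (norm (x - y))\<^sup>2 - (inner (x - y) z)\<^sup>2 / inner z z"
    using False by (simp add: t_def power2_eq_square field_simps)
  finally have "(inner (x - y) z)\<^sup>2 / inner z z \<le> 0" by simp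
  then show ?thesis
    using False by (metis divide_pos_pos inner_gt_zero_iff not_le zero_less_power2)
qed simp

text \<open>A minimizing sequence is Cauchy by the parallelogram law, because midpoints of its terms
  stay in \<open>S\<close> and so have distance at least \<open>d\<close> from
  \<open>x\<close>.\<close>

lemma nearest_point_exists:
  fixes S :: "'a::{real_inner, complete_space} set"
  assumes S: "subspace S" "closed S"
  obtains y where "y \<in> S" "\<And>z. z \<in> S \<Longrightarrow> dist x y \<le> dist x z"
proof -
  define d where "d = infdist x S"
  have ne: "S \<noteq> {}" using subspace_0[OF S(1)] by auto
  have dnn: "0 \<le> d" by (simp add: d_def infdist_nonneg)
  have d_le: "d \<le> dist x z" if "z \<in> S" for z
    using that by (simp add: d_def infdist_le)
  have "\<exists>y\<in>S. dist x y < d + inverse (real (Suc k))" for k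
    using cInf_lessD[of "dist x ` S" "d + inverse (real (Suc k))"] ne
    by (auto simp: d_def infdist_notempty)
  then obtain Y where Y: "\<And>k. Y k \<in> S" "\<And>k. dist x (Y k) < d + inverse (real (Suc k))"
    by metis
  have lim: "(\<lambda>k. dist x (Y k)) \<longlonglongrightarrow> d"
  proof (rule tendsto_sandwich[of "\<lambda>_. d" _ _ "\<lambda>k. d + inverse (real (Suc k))"])
    show "(\<lambda>k. d + inverse (real (Suc k))) \<longlonglongrightarrow> d"
      using LIMSEQ_inverse_real_of_nat_add .
    show "\<forall>\<^sub>F k in sequentially. dist x (Y k) \<le> d + inverse (real (Suc k))"
      using Y(2) by (intro always_eventually allI less_imp_le)
  qed (use Y d_le in auto)
  have par: "(dist (Y i) (Y j))\<^sup>2 \<le> 2 * ((dist x (Y i))\<^sup>2 - d\<^sup>2) + 2 * ((dist x (Y j))\<^sup>2 - d\<^sup>2)" for i j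
  proof -
    have "(1/2) *\<^sub>R (Y i + Y j) \<in> S" using S Y by (simp add: subspace_add subspace_mul)
    then have "d\<^sup>2 \<le> (dist x ((1/2) *\<^sub>R (Y i + Y j)))\<^sup>2"
      using d_le dnn by (intro power_mono) auto
    moreover have "(dist (Y i) (Y j))\<^sup>2 + 4 * (dist x ((1/2) *\<^sub>R (Y i + Y j)))\<^sup>2 =
        2 * (dist x (Y i))\<^sup>2 + 2 * (dist x (Y j))\<^sup>2"
      unfolding dist_norm power2_norm_eq_inner
      by (simp add: inner_diff_left inner_diff_right inner_add_left inner_add_right inner_commute field_simps)
    ultimately show ?thesis by argo
  qed
  have "Cauchy Y"
  proof (rule metric_CauchyI)
    fix e :: real assume "0 < e"
    have "(\<lambda>k. (dist x (Y k))\<^sup>2 - d\<^sup>2) \<longlonglongrightarrow> d\<^sup>2 - d\<^sup>2"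
      by (intro tendsto_intros lim)
    then have "\<forall>\<^sub>F k in sequentially. (dist x (Y k))\<^sup>2 - d\<^sup>2 < e\<^sup>2 / 4"
      using \<open>0 < e\<close> by (intro order_tendstoD) auto
    then obtain K where K: "\<And>k. k \<ge> K \<Longrightarrow> (dist x (Y k))\<^sup>2 - d\<^sup>2 < e\<^sup>2 / 4"
      by (auto simp: eventually_sequentially)
    have "dist (Y i) (Y j) < e" if "i \<ge> K" "j \<ge> K" for i j
    proof (rule power_less_imp_less_base)
      show "(dist (Y i) (Y j))\<^sup>2 < e\<^sup>2"
        using par[of i j] K[OF that(1)] K[OF that(2)] by argo
    qed (use \<open>0 < e\<close> in simp)
    then show "\<exists>M. \<forall>m\<ge>M. \<forall>n\<ge>M. dist (Y m) (Y n) < e" by blast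
  qed
  then obtain y where y: "Y \<longlonglongrightarrow> y"
    using Cauchy_convergent convergentD by blast
  then have "(\<lambda>k. dist x (Y k)) \<longlonglongrightarrow> dist x y" by (intro tendsto_intros)
  then have "dist x y = d" using LIMSEQ_unique lim by blast
  then show ?thesis
    using that[of y] d_le closed_sequentially[OF S(2) Y(1) y] by simp
qed

lemma real_subspace_if_csubspace: "complex_vector.subspace M \<Longrightarrow> subspace M"
  by (auto simp: subspace_def complex_vector.subspace_def scaleR_scaleC)

lemma orthogonal_decomposition:
  fixes M :: "'a::complex_hilbert_space set"
  assumes M: "closed_csubspace M"
  obtains y where "y \<in> M" "\<And>z. z \<in> M \<Longrightarrow> cinner (x - y) z = 0"
proof -
  from M have sub: "complex_vector.subspace M" "subspace M" "closed M"
    by (auto simp: closed_csubspace_def real_subspace_if_csubspace)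
  obtain y where y: "y \<in> M" "\<And>z. z \<in> M \<Longrightarrow> dist x y \<le> dist x z"
    using nearest_point_exists[OF sub(2,3)] by metis
  have orth: "inner (x - y) z = 0" if "z \<in> M" for z
    using nearest_point_orthogonal[OF sub(2) y that] .
  have "cinner (x - y) z = 0" if "z \<in> M" for z
  proof -
    \<comment> \<open>Real orthogonality to \<open>z\<close> kills the real part of
      \<open>cinner (x - y) z\<close>, and real orthogonality to \<open>\<i> z\<close> kills its
      imaginary part.\<close>
    have "\<i> *\<^sub>C z \<in> M" using sub that by (simp add: complex_vector.subspace_scale)
    from orth[OF this] orth[OF that] show ?thesis
      by (simp add: complex_eq_iff inner_eq_Re_cinner cinner_scaleC_right)
  qed
  with y that show ?thesis by blast
qed

lemma orthogonal_vector:
  fixes M :: "'a::complex_hilbert_space set"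
  assumes "closed_csubspace M" "M \<noteq> UNIV"
  obtains f where "f \<noteq> 0" "\<And>z. z \<in> M \<Longrightarrow> cinner z f = 0"
proof -
  from assms obtain x where x: "x \<notin> M" by auto
  obtain y where y: "y \<in> M" "\<And>z. z \<in> M \<Longrightarrow> cinner (x - y) z = 0"
    using orthogonal_decomposition[OF assms(1)] by metis
  show ?thesis
  proof (rule that[of "x - y"])
    show "x - y \<noteq> 0" using x y by auto
    show "cinner z (x - y) = 0" if "z \<in> M" for z
      using y(2)[OF that] cinner_commute[of z "x - y"] by simp
  qed
qed

text \<open>The orthogonality of \<open>x - p x\<close> to \<open>M\<close> determines
  \<open>p x \<in> M\<close> uniquely; this makes \<open>p\<close> linear, and Pythagoras makes it a
  contraction.\<close>

lemma projection_onto: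
  fixes M :: "'a::complex_hilbert_space set"
  assumes M: "closed_csubspace M"
  obtains P :: "'a \<Rightarrow>\<^sub>L 'a" where "clinear_op P" "\<And>x. P x \<in> M" "\<And>x. x \<in> M \<Longrightarrow> P x = x"
proof -
  from M have sub: "complex_vector.subspace M" by (simp add: closed_csubspace_def)
  have "\<forall>x. \<exists>y. y \<in> M \<and> (\<forall>z\<in>M. cinner (x - y) z = 0)"
    using orthogonal_decomposition[OF M] by metis
  then obtain p where p: "\<And>x. p x \<in> M" "\<And>x z. z \<in> M \<Longrightarrow> cinner (x - p x) z = 0"
    by metis
  have unique: "p x = y" if "y \<in> M" "\<And>z. z \<in> M \<Longrightarrow> cinner (x - y) z = 0" for x y
  proof -
    have "y - p x \<in> M" using that p sub by (simp add: complex_vector.subspace_diff)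
    from that(2)[OF this] p(2)[OF this, of x] have "cinner (y - p x) (y - p x) = 0"
      by (simp add: cinner_diff_left)
    then show ?thesis by simp
  qed
  have add: "p (x + y) = p x + p y" for x y
  proof (rule unique)
    show "cinner (x + y - (p x + p y)) z = 0" if "z \<in> M" for z
      using p(2)[OF that, of x] p(2)[OF that, of y]
      by (simp add: add_diff_add cinner_add_left)
  qed (use p sub in \<open>simp add: complex_vector.subspace_add\<close>)
  have scale: "p (c *\<^sub>C x) = c *\<^sub>C p x" for c x
  proof (rule unique)
    show "cinner (c *\<^sub>C x - c *\<^sub>C p x) z = 0" if "z \<in> M" for z
      using p(2)[OF that, of x]
      by (simp add: cinner_scaleC_left complex_vector.scale_right_diff_distrib[symmetric])
  qed (use p sub in \<open>simp add: complex_vector.subspace_scale\<close>)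
  have "norm (p x) \<le> norm x" for x
  proof -
    have "inner (x - p x) (p x) = 0" using p by (simp add: inner_eq_Re_cinner)
    then have "(norm x)\<^sup>2 = (norm (x - p x))\<^sup>2 + (norm (p x))\<^sup>2"
      unfolding power2_norm_eq_inner
      by (simp add: inner_diff_left inner_diff_right inner_commute)
    then have "(norm (p x))\<^sup>2 \<le> (norm x)\<^sup>2" by simp
    then show ?thesis by (rule power2_le_imp_le) simp
  qed
  then have "bounded_linear p"
    by (intro bounded_linear_intro[where K = 1]) (auto simp: add scaleR_scaleC scale)
  then have [simp]: "blinfun_apply (Blinfun p) = p" by (rule bounded_linear_Blinfun_apply)
  show ?thesis
    by (rule that[of "Blinfun p"]) (use p unique in \<open>auto simp: clinear_op_def scale\<close>)
qed

section \<open>Nest algebras\<close>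

lemma nest_alg_iff: "A \<in> nest_alg \<N> \<longleftrightarrow> clinear_op A \<and> (\<forall>M\<in>\<N>. \<forall>x\<in>M. A x \<in> M)"
  by (auto simp: nest_alg_def)

locale nest_algebra =
  fixes \<N> :: "'h::complex_hilbert_space set set"
  assumes nest: "nest \<N>"
begin

lemma member: "M \<in> \<N> \<Longrightarrow> closed_csubspace M" "M \<in> \<N> \<Longrightarrow> complex_vector.subspace M"
  using nest by (auto simp: nest_def closed_csubspace_def)

lemma chain: "L \<in> \<N> \<Longrightarrow> M \<in> \<N> \<Longrightarrow> L \<subseteq> M \<or> M \<subseteq> L"
  using nest by (auto simp: nest_def)

sublocale operator_subring "nest_alg \<N>"
proof
  show "A - B \<in> nest_alg \<N>" if "A \<in> nest_alg \<N>" "B \<in> nest_alg \<N>" for A B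
    using that member
    by (auto simp: nest_alg_iff clinear_op_def blinfun.diff_left complex_vector.scale_right_diff_distrib
        complex_vector.subspace_diff)
qed (auto simp: nest_alg_iff clinear_op_def)

lemma clinear: "A \<in> nest_alg \<N> \<Longrightarrow> clinear_op A"
  by (simp add: nest_alg_iff)

section \<open>Rank-one operators and idempotents of a nest algebra\<close>

text \<open>The condition for \<open>outer x f\<close> to leave every member invariant: on
  \<open>M\<close> its values are multiples of \<open>x \<in> M\<close>, or it vanishes
  there.\<close>

definition admissible :: "'h \<Rightarrow> 'h \<Rightarrow> bool" where
  "admissible x f \<longleftrightarrow> (\<forall>M\<in>\<N>. x \<in> M \<or> (\<forall>z\<in>M. cinner z f = 0))"

definition rank_ones :: "('h \<Rightarrow>\<^sub>L 'h) set" where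
  "rank_ones = {outer x f | x f. admissible x f}"

lemma outer_mem: "admissible x f \<Longrightarrow> outer x f \<in> nest_alg \<N>"
  using member
  by (fastforce simp: nest_alg_iff clinear_outer admissible_def complex_vector.subspace_scale complex_vector.subspace_0)

lemma rank_ones_left_ideal:
  assumes "A \<in> nest_alg \<N>" "X \<in> rank_ones"
  shows "A \<cdot> X \<in> rank_ones"
proof -
  from assms obtain x f where X: "X = outer x f" "admissible x f" by (auto simp: rank_ones_def)
  then have "A \<cdot> X = outer (A x) f" "admissible (A x) f"
    using assms by (auto simp: compose_outer nest_alg_iff admissible_def)
  then show ?thesis by (auto simp: rank_ones_def)
qed

text \<open>Let \<open>K\<close> be the closed span of all proper members. If \<open>K\<close> is
  the whole space, \<open>T\<close> vanishes on each proper member and hence on a dense subspace.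
  Otherwise a nonzero \<open>f\<close> orthogonal to \<open>K\<close> is admissible with every
  \<open>x\<close>.\<close>

lemma rank_ones_separating:
  assumes T: "T \<in> nest_alg \<N>" and zero: "\<And>X. X \<in> rank_ones \<Longrightarrow> T \<cdot> X = 0"
  shows "T = 0"
proof -
  have Tx: "T x = 0" if "admissible x f" "f \<noteq> 0" for x f
  proof -
    have "T \<cdot> outer x f = 0" using that zero by (auto simp: rank_ones_def)
    then have "(T \<cdot> outer x f) f = 0" by simp
    then have "cinner f f *\<^sub>C T x = 0" by (simp add: clinear_opD[OF clinear[OF T]])
    with that show ?thesis by simp
  qed
  let ?F = "\<N> - {UNIV}" and ?ker = "{x. T x = 0}"
  let ?K = "closure (complex_vector.span (\<Union>?F))"
  have K: "?K \<in> \<N>" using nest by (auto simp: nest_def)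
  have "T x = 0" for x
  proof (cases "?K = UNIV")
    case True
    have "\<Union>?F \<subseteq> ?ker"
    proof clarify
      fix x M assume M: "M \<in> \<N>" "x \<in> M" "M \<noteq> UNIV"
      then obtain f where f: "f \<noteq> 0" "\<And>z. z \<in> M \<Longrightarrow> cinner z f = 0"
        using orthogonal_vector[OF member(1)] by metis
      \<comment> \<open>Every member is contained in \<open>M\<close>, hence annihilated by
        \<open>f\<close>, or contains \<open>M\<close>, hence \<open>x\<close>.\<close>
      have "admissible x f"
        unfolding admissible_def using chain[OF M(1)] f M by blast
      with f show "T x = 0" using Tx by blast
    qed
    moreover have "complex_vector.subspace ?ker"
      by (auto simp: complex_vector.subspace_def blinfun.add_right clinear_opD[OF clinear[OF T]])
    ultimately have "complex_vector.span (\<Union>?F) \<subseteq> ?ker"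
      by (rule complex_vector.span_minimal)
    moreover have "closed ?ker"
      by (intro closed_Collect_eq continuous_intros)
    ultimately have "?K \<subseteq> ?ker" by (rule closure_minimal)
    with True show ?thesis by auto
  next
    case False
    obtain f where f: "f \<noteq> 0" "\<And>z. z \<in> ?K \<Longrightarrow> cinner z f = 0"
      using orthogonal_vector[OF member(1)[OF K] False] by metis
    have "M \<subseteq> ?K" if "M \<in> ?F" for M
      using that complex_vector.span_superset[of "\<Union>?F"] closure_subset by blast
    then have "admissible x f"
      unfolding admissible_def using f by blast
    with f show ?thesis using Tx by blast
  qed
  then show ?thesis by (auto intro: blinfun_eqI)
qed

text \<open>\<open>Q A P B Q\<close> maps \<open>z\<close> to the scalar
  \<open>cinner (B (Q z)) f\<close> times the fixed vector \<open>Q A x\<close>, so it is zero only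
  if the scalar vanishes for all \<open>z\<close> or the vector is zero.\<close>

lemma good_outer:
  assumes "admissible x f" "cinner x f = 1"
  shows "good_idempotent (outer x f)"
  unfolding good_idempotent_def
proof (intro conjI ballI impI)
  let ?P = "outer x f" let ?Q = "id_blinfun - ?P"
  show mem: "?P \<in> nest_alg \<N>" using assms outer_mem by blast
  show "?P \<cdot> ?P = ?P" using assms by (simp add: compose_outer clinear_outer scaleC_one)
  fix A B assume AB: "A \<in> nest_alg \<N>" "B \<in> nest_alg \<N>" and 0: "?Q \<cdot> A \<cdot> ?P \<cdot> B \<cdot> ?Q = 0"
  have QA: "clinear_op (?Q \<cdot> A)" using mem AB clinear by simp
  have "cinner (B (?Q z)) f *\<^sub>C (?Q \<cdot> A) x = 0" for z
  proof -
    have "(?Q \<cdot> A \<cdot> ?P \<cdot> B \<cdot> ?Q) z = (?Q \<cdot> A) (cinner (B (?Q z)) f *\<^sub>C x)" by simp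
    with 0 show ?thesis by (simp only: clinear_opD[OF QA]) simp
  qed
  then consider "(?Q \<cdot> A) x = 0" | "\<And>z. cinner (B (?Q z)) f = 0" by fastforce
  then show "?Q \<cdot> A \<cdot> ?P = 0 \<or> ?P \<cdot> B \<cdot> ?Q = 0"
  proof cases
    case 1
    then have "?Q \<cdot> A \<cdot> ?P = 0"
      using compose_outer[OF QA, of x f] by (auto intro!: blinfun_eqI)
    then show ?thesis ..
  next
    case 2
    then have "?P \<cdot> B \<cdot> ?Q = 0" by (auto intro!: blinfun_eqI)
    then show ?thesis ..
  qed
qed

lemma projection_mem:
  assumes M: "M \<in> \<N>" and P: "clinear_op P" "\<And>x. P x \<in> M" "\<And>x. x \<in> M \<Longrightarrow> P x = x"
  shows "P \<in> nest_alg \<N>"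
  unfolding nest_alg_iff
proof (intro conjI ballI)
  fix L x assume L: "L \<in> \<N>" "x \<in> L"
  from chain[OF this(1) M] show "P x \<in> L"
    using P L by (metis subsetD)
qed fact

text \<open>The algebra leaves \<open>M\<close> invariant, so \<open>(1 - P) A P = 0\<close> and the
  first alternative of goodness always holds.\<close>

lemma good_projection:
  assumes M: "M \<in> \<N>" and P: "clinear_op P" "\<And>x. P x \<in> M" "\<And>x. x \<in> M \<Longrightarrow> P x = x"
  shows "good_idempotent P"
proof -
  have "(id_blinfun - P) \<cdot> A \<cdot> P = 0" if "A \<in> nest_alg \<N>" for A
    using that M P by (auto intro!: blinfun_eqI simp: blinfun.diff_left nest_alg_iff)
  moreover have "P \<cdot> P = P" using P by (auto intro: blinfun_eqI)
  ultimately show ?thesis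
    using projection_mem[OF assms] by (simp add: good_idempotent_def)
qed

text \<open>The intersection of all members containing \<open>x\<close> is a member; as every member
  containing \<open>x\<close> contains all of it, its vectors may replace \<open>x\<close> in an
  admissible pair.\<close>

lemma least_member:
  obtains M where "M \<in> \<N>" "x \<in> M" "\<And>y f. y \<in> M \<Longrightarrow> admissible x f \<Longrightarrow> admissible y f"
    "\<And>L. L \<in> \<N> \<Longrightarrow> x \<in> L \<Longrightarrow> M \<subseteq> L"
proof
  let ?M = "\<Inter>{L \<in> \<N>. x \<in> L}"
  show "?M \<in> \<N>" using nest unfolding nest_def by (metis (no_types, lifting) mem_Collect_eq subsetI)
qed (auto simp: admissible_def)

text \<open>
  A square-zero rank-one operator \<open>x \<otimes> f\<close> is a corner of an idempotent \<open>P\<close>: either \<open>P = y \<otimes> f\<close> with \<open>y\<close>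
  in the least member \<open>M\<close> containing \<open>x\<close>, or \<open>f\<close> annihilates \<open>M\<close> and \<open>P\<close> projects onto \<open>M\<close>.
\<close>

lemma square_zero_rank_one:
  assumes adm: "admissible x f" and 0: "cinner x f = 0"
  obtains P P' where "good_idempotent P" "good_idempotent P'" "outer x f = P' - P"
    "outer x f = (id_blinfun - P) \<cdot> outer x f \<cdot> P \<or> outer x f = P \<cdot> outer x f \<cdot> (id_blinfun - P)"
proof -
  obtain M where M: "M \<in> \<N>" "x \<in> M" "\<And>y f. y \<in> M \<Longrightarrow> admissible x f \<Longrightarrow> admissible y f"
    using least_member by metis
  note sub = member(2)[OF M(1)]
  show ?thesis
  proof (cases "\<forall>z\<in>M. cinner z f = 0")
    case False
    then obtain z where z: "z \<in> M" "cinner z f \<noteq> 0" by auto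
    define y where "y = inverse (cinner z f) *\<^sub>C z"
    have y: "y \<in> M" "cinner y f = 1"
      using z sub by (auto simp: y_def complex_vector.subspace_scale cinner_scaleC_left)
    have xy: "x + y \<in> M" using M y sub by (simp add: complex_vector.subspace_add)
    show ?thesis
    \<comment> \<open>As \<open>cinner x f = 0\<close>, adding \<open>x\<close> to \<open>y\<close>
      keeps \<open>cinner (x + y) f = 1\<close>.\<close>
    proof (rule that[of "outer y f" "outer (x + y) f"])
      show "good_idempotent (outer y f)" "good_idempotent (outer (x + y) f)"
        using adm M(3) y xy 0 by (auto intro!: good_outer simp: cinner_add_left)
      show "outer x f = outer (x + y) f - outer y f"
        by (simp flip: outer_diff_left)
      have "outer x f = (id_blinfun - outer y f) \<cdot> outer x f \<cdot> outer y f"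
        by (rule blinfun_eqI) (simp add: blinfun.diff_left cinner_scaleC_left 0 y)
      then show "outer x f = (id_blinfun - outer y f) \<cdot> outer x f \<cdot> outer y f \<or>
        outer x f = outer y f \<cdot> outer x f \<cdot> (id_blinfun - outer y f)" ..
    qed
  next
    case True
    obtain P :: "'h \<Rightarrow>\<^sub>L 'h" where P: "clinear_op P" "\<And>x. P x \<in> M" "\<And>x. x \<in> M \<Longrightarrow> P x = x"
      using projection_onto[OF member(1)[OF M(1)]] by metis
    show ?thesis
    \<comment> \<open>As \<open>x \<in> M\<close> and \<open>f\<close> annihilates \<open>M\<close>,
      the operator \<open>P + outer x f\<close> still maps into \<open>M\<close> and fixes
      \<open>M\<close> pointwise.\<close>
    proof (rule that[of P "P + outer x f"])
      show "good_idempotent P" by (rule good_projection[OF M(1) P])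
      show "good_idempotent (P + outer x f)"
      proof (rule good_projection[OF M(1)])
        show "clinear_op (P + outer x f)"
          using P(1) clinear_outer[of x f]
          by (simp add: clinear_op_def blinfun.add_left scaleC_add_right del: outer.rep_eq)
      qed (use P M True sub in \<open>auto simp: blinfun.add_left complex_vector.subspace_add complex_vector.subspace_scale\<close>)
      have "outer x f = P \<cdot> outer x f \<cdot> (id_blinfun - P)"
        using P M True
        by (intro blinfun_eqI) (simp add: blinfun.diff_left clinear_opD cinner_diff_left)
      then show "outer x f = (id_blinfun - P) \<cdot> outer x f \<cdot> P \<or> outer x f = P \<cdot> outer x f \<cdot> (id_blinfun - P)" ..
    qed simp
  qed
qed

lemma rank_one_cases:
  assumes "X \<in> rank_ones"
  obtains c P where "good_idempotent P" "X = scaleC_op c P"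
  | P P' where "good_idempotent P" "good_idempotent P'" "X = P' - P"
proof -
  from assms obtain x f where X: "X = outer x f" "admissible x f" by (auto simp: rank_ones_def)
  show ?thesis
  proof (cases "cinner x f = 0")
    case True
    then show ?thesis using that(2) square_zero_rank_one[OF X(2) True] X by metis
  next
    case False
    define y where "y = inverse (cinner x f) *\<^sub>C x"
    have "admissible y f"
      using X(2) member unfolding admissible_def y_def by (metis complex_vector.subspace_scale)
    moreover have "cinner y f = 1" using False by (simp add: y_def cinner_scaleC_left)
    moreover have "X = scaleC_op (cinner x f) (outer y f)"
      using False by (auto intro!: blinfun_eqI simp: X y_def scaleC_scaleC)
    ultimately show ?thesis using that(1) good_outer by blast
  qed
qed

text \<open>
  If \<open>D x \<noteq> 0\<close> for some idempotent \<open>x \<otimes> f\<close> of the algebra, then \<open>x\<close> spans the least member of the nest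
  containing it, and every vector orthogonal to \<open>x\<close> yields a square-zero operator \<open>x \<otimes> g\<close>.
\<close>

lemma central_annihilating_corners_eq_0:
  assumes dim: "complex_vector.dim (UNIV :: 'h set) \<noteq> 1"
    and D: "D \<in> nest_alg \<N>" "\<And>A. A \<in> nest_alg \<N> \<Longrightarrow> A \<cdot> D = D \<cdot> A"
    and corner: "\<And>P A. good_idempotent P \<Longrightarrow> A \<in> nest_alg \<N> \<Longrightarrow> D \<cdot> ((id_blinfun - P) \<cdot> A \<cdot> P) = 0"
      "\<And>P A. good_idempotent P \<Longrightarrow> A \<in> nest_alg \<N> \<Longrightarrow> D \<cdot> (P \<cdot> A \<cdot> (id_blinfun - P)) = 0"
  shows "D = 0"
proof (rule rank_ones_separating[OF D(1)])
  have sq0: "D \<cdot> outer x f = 0" if "admissible x f" "cinner x f = 0" for x f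
    by (rule square_zero_rank_one[OF that]) (metis corner outer_mem[OF that(1)])
  have Dlin: "D (c *\<^sub>C x) = c *\<^sub>C D x" for c x
    by (rule clinear_opD[OF clinear[OF D(1)]])
  \<comment> \<open>For \<open>X = outer x f\<close>, centrality turns \<open>D X = 0\<close> into
    \<open>X D = 0\<close> as well; the two alternatives evaluate these operators.\<close>
  have sq0': "x = 0 \<or> cinner (D z) f = 0" "f = 0 \<or> D x = 0" if "admissible x f" "cinner x f = 0" for x f z
  proof -
    have "(outer x f \<cdot> D) z = 0" "(D \<cdot> outer x f) f = 0"
      using sq0[OF that] D(2)[OF outer_mem[OF that(1)]] by simp_all
    then show "x = 0 \<or> cinner (D z) f = 0" "f = 0 \<or> D x = 0"
      by (auto simp: Dlin)
  qed
  fix X assume "X \<in> rank_ones"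
  then obtain x f where X: "X = outer x f" "admissible x f" by (auto simp: rank_ones_def)
  have "cinner x f = 0 \<or> D x = 0"
  proof (rule ccontr)
    assume "\<not> (cinner x f = 0 \<or> D x = 0)"
    then have xf: "cinner x f \<noteq> 0" and Dx: "D x \<noteq> 0" by auto
    then have "x \<noteq> 0" by auto
    have "(outer x f \<cdot> D) x = (D \<cdot> outer x f) x" using D(2)[OF outer_mem[OF X(2)]] by simp
    then have "cinner (D x) f *\<^sub>C x = cinner x f *\<^sub>C D x" by (simp add: Dlin)
    then have fD: "cinner (D x) f \<noteq> 0" using xf Dx by auto
    obtain M where M: "M \<in> \<N>" "x \<in> M" "\<And>y f. y \<in> M \<Longrightarrow> admissible x f \<Longrightarrow> admissible y f"
        "\<And>L. L \<in> \<N> \<Longrightarrow> x \<in> L \<Longrightarrow> M \<subseteq> L"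
      using least_member by metis
    note sub = member(2)[OF M(1)]
    have line: "\<exists>c. y = c *\<^sub>C x" if "y \<in> M" for y
    proof -
      \<comment> \<open>The multiple of \<open>x\<close> is chosen so that \<open>f\<close>
        annihilates the remainder \<open>y'\<close>; if \<open>y'\<close> were nonzero,
        \<open>sq0'\<close> would give \<open>cinner (D x) f = 0\<close>.\<close>
      let ?c = "cinner y f / cinner x f" let ?y' = "y - ?c *\<^sub>C x"
      have "?y' \<in> M" using that M sub by (simp add: complex_vector.subspace_diff complex_vector.subspace_scale)
      then have "admissible ?y' f" using M X by blast
      moreover have "cinner ?y' f = 0" using xf by (simp add: cinner_diff_left cinner_scaleC_left)
      ultimately have "?y' = 0" using sq0' fD by blast
      then show ?thesis by auto
    qed
    have "g = 0" if g: "cinner x g = 0" for g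
    proof -
      \<comment> \<open>A member without \<open>x\<close> lies in \<open>M\<close>, which is the
        line through \<open>x\<close>, so \<open>g\<close> annihilates it.\<close>
      have "\<forall>z\<in>L. cinner z g = 0" if L: "L \<in> \<N>" "x \<notin> L" for L
      proof
        fix z assume z: "z \<in> L"
        from L M chain have "L \<subseteq> M" by blast
        then obtain c where "z = c *\<^sub>C x" using z line by blast
        then show "cinner z g = 0" by (simp add: cinner_scaleC_left g)
      qed
      then have "admissible x g" by (auto simp: admissible_def)
      from sq0'(2)[OF this g] Dx show ?thesis by blast
    qed
    then have orth: "g = 0" if "cinner g x = 0" for g
      using that cinner_commute[of x g] by simp
    have "y = (cinner y x / cinner x x) *\<^sub>C x" for y
    proof -
      have "cinner (y - (cinner y x / cinner x x) *\<^sub>C x) x = 0"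
        using \<open>x \<noteq> 0\<close> by (simp add: cinner_diff_left cinner_scaleC_left)
      from orth[OF this] show ?thesis by simp
    qed
    then have "UNIV \<subseteq> complex_vector.span {x}"
      by (metis complex_vector.span_base complex_vector.span_scale singletonI subsetI)
    with \<open>x \<noteq> 0\<close> have "complex_vector.dim (UNIV :: 'h set) = 1"
      by (intro complex_vector.dim_unique[of "{x}"]) auto
    with dim show False by contradiction
  qed
  then show "D \<cdot> X = 0"
  proof
    assume "D x = 0"
    then show ?thesis by (simp add: X compose_outer[OF clinear[OF D(1)]]) (auto intro: blinfun_eqI)
  qed (simp add: X sq0)
qed

end

theorem corollary2p11:
  fixes m n :: int
    and \<N> :: "'h::complex_hilbert_space set set"
    and \<delta> :: "('h \<Rightarrow>\<^sub>L 'h) \<Rightarrow> ('h \<Rightarrow>\<^sub>L 'h)"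
  assumes "m \<noteq> 0" and "n \<noteq> 0" and "m + n \<noteq> 0"
    and "separable_space (euclidean :: 'h topology)"
    and "complex_vector.dim (UNIV :: 'h set) \<noteq> 1"
    and "nest \<N>"
    and "derivable_at_zero m n (nest_alg \<N>) \<delta>"
  shows "derivation_on (nest_alg \<N>) \<delta>"
proof -
  interpret nest_algebra \<N> by unfold_locales fact
  let ?A = "nest_alg \<N>" let ?D = "\<delta> id_blinfun"
  have lin: "linear_selfmap_on ?A \<delta>" using assms(7) by (simp add: derivable_at_zero_def)
  then have mem: "\<And>A. A \<in> ?A \<Longrightarrow> \<delta> A \<in> ?A"
    and add: "\<And>A B. A \<in> ?A \<Longrightarrow> B \<in> ?A \<Longrightarrow> \<delta> (A + B) = \<delta> A + \<delta> B"
    and scale: "\<And>c A. A \<in> ?A \<Longrightarrow> \<delta> (scaleC_op c A) = scaleC_op c (\<delta> A)"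
    by (auto simp: linear_selfmap_on_def)
  have diff: "\<delta> (A - B) = \<delta> A - \<delta> B" if "A \<in> ?A" "B \<in> ?A" for A B
    using add[of "A - B" B] that by (simp add: algebra_simps)
  have \<delta>0: "\<delta> 0 = 0" using add[of 0 0] by simp
  interpret zero_derivable ?A "of_int m" "of_int n" \<delta>
  proof
    show "real_of_int m + real_of_int n \<noteq> 0" using assms(3) by linarith
    show "of_int n *\<^sub>R \<delta> (B \<cdot> A) =
        of_int m *\<^sub>R (\<delta> A \<cdot> B + A \<cdot> \<delta> B) + of_int n *\<^sub>R (\<delta> B \<cdot> A + B \<cdot> \<delta> A)"
      if "A \<in> ?A" "B \<in> ?A" "A \<cdot> B = 0" for A B
      using that assms(7) \<delta>0 by (simp add: derivable_at_zero_def scaleR_add_right add.assoc)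
  qed (use assms mem add in auto)
  have good: "P \<in> ?A" "P \<cdot> P = P" if "good_idempotent P" for P
    using that by (auto simp: good_idempotent_def)
  have commutes: "?D \<cdot> X = X \<cdot> ?D" if "X \<in> rank_ones" for X
    using that
  proof (cases rule: rank_one_cases)
    case (1 c P)
    then show ?thesis
      using \<delta>_id_commutes[OF good] clinear[OF mem[OF id_mem]]
      by (simp add: compose_scaleC_op_right compose_scaleC_op_left)
  next
    case (2 P P')
    then show ?thesis
      using \<delta>_id_commutes[OF good] by (simp add: blinfun_ring_simps)
  qed
  have central: "A \<cdot> ?D = ?D \<cdot> A" if "A \<in> ?A" for A
    by (rule central_if_on_separating_left_ideal[OF rank_ones_left_ideal rank_ones_separating])
      (simp_all add: that mem commutes)
  interpret twisted: twisted_derivable ?A "of_int m" "of_int n" ?D "\<lambda>A. \<delta> A - ?D \<cdot> A"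
    by (rule twisted[OF central])
  \<comment> \<open>Dimension one is excluded here; once \<open>D\<close> is zero, the twisted map
    is \<open>\<delta>\<close> itself.\<close>
  have D0: "?D = 0"
    by (rule central_annihilating_corners_eq_0[OF assms(5)]) (simp_all add: mem central twisted.peirce)
  have deriv_good: "\<delta> (A \<cdot> P) = \<delta> A \<cdot> P + A \<cdot> \<delta> P" if "good_idempotent P" "A \<in> ?A" for A P
    using twisted.peirce(1)[OF that] by (simp add: D0)
  \<comment> \<open>Multiples of idempotents use the complex homogeneity of \<open>\<delta>\<close>,
    differences its additivity.\<close>
  have deriv_rank_one: "\<delta> (A \<cdot> X) = \<delta> A \<cdot> X + A \<cdot> \<delta> X" if X: "X \<in> rank_ones" and A: "A \<in> ?A" for A X
    using X
  proof (cases rule: rank_one_cases)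
    case (1 c P)
    then show ?thesis
      using A good deriv_good clinear mem
      by (simp add: compose_scaleC_op_right scale scaleC_op_add)
  next
    case (2 P P')
    then show ?thesis
      using A good deriv_good by (simp add: blinfun_ring_simps diff)
  qed
  have "\<delta> (A \<cdot> B) = \<delta> A \<cdot> B + A \<cdot> \<delta> B" if "A \<in> ?A" "B \<in> ?A" for A B
    by (rule derivation_if_on_separating_left_ideal[OF rank_ones_left_ideal rank_ones_separating])
      (simp_all add: that mem deriv_rank_one)
  with lin show ?thesis by (simp add: derivation_on_def)
qed

end
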